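(* Let $q=p^r$ with $p$ prime, $q\equiv 1\pmod 4$ and $r\geq 2$. Let $\psi:\mathbb{F}_q^2\to\mathbb{F}_q^2$ be the map given in hyperbolic coordinates by $(\alpha,\beta)\mapsto(\alpha,\beta^p)$. Then $\psi$ is an integral automorphism of $\mathbb{F}_q^2$, but not an affine integral automorphism.
   Context: $\mathbb{F}_q$ is the field with $q$ elements, $\square_q$ the set of squares in $\mathbb{F}_q$ including $0$, and $N(x_1,x_2)=x_1^2+x_2^2$ for $(x_1,x_2)\in\mathbb{F}_q^2$. Points $x,y\in\mathbb{F}_q^2$ are at integral distance if $N(x-y)\in\square_q$. An integral automorphism is a bijection $\phi:\mathbb{F}_q^2\to\mathbb{F}_q^2$ preserving integral distances, i.e. mapping pairs of points at integral distance to pairs of points at integral distance. An affine integral automorphism is an integral automorphism that is also an automorphism of the affine plane $\mathbb{F}_q^2$ (it maps affine lines to affine lines). For $q\equiv1\pmod 4$ fix $\omega\in\mathbb{F}_q$ with $\omega^2=-1$ and let $a=\frac12(1,\omega)$, $b=\frac12(1,-\omega)$, which form a basis of $\mathbb{F}_q^2$. A point $P\in\mathbb{F}_q^2$ has hyperbolic coordinates $(\alpha,\beta)\in\mathbb{F}_q^2$ if $P=\alpha a+\beta b$. Thus $\psi(\alpha a+\beta b)=\alpha a+\beta^p b$. *)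

theory Defs
  imports "HOL-Analysis.Cartesian_Space" "HOL-Computational_Algebra.Primes"
begin

text \<open>
  The field with q elements is a type \<open>'a :: {field, finite}\<close> with \<open>CARD('a) = q\<close>,
  and the affine plane over it is \<open>'a ^ 2\<close>, with scalar multiplication \<open>*s\<close>.
\<close>

definition squares :: "'a::field set" where
  "squares = {c. \<exists>d. c = d ^ 2}"

definition quad_norm :: "'a::field ^ 2 \<Rightarrow> 'a" where
  "quad_norm x = (x $ 1) ^ 2 + (x $ 2) ^ 2"

definition integral_distance :: "'a::field ^ 2 \<Rightarrow> 'a ^ 2 \<Rightarrow> bool" where
  "integral_distance x y \<longleftrightarrow> quad_norm (x - y) \<in> squares"

definition integral_automorphism :: "('a::field ^ 2 \<Rightarrow> 'a ^ 2) \<Rightarrow> bool" where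
  "integral_automorphism \<phi> \<longleftrightarrow>
     bij \<phi> \<and> (\<forall>x y. integral_distance x y \<longrightarrow> integral_distance (\<phi> x) (\<phi> y))"

definition affine_line :: "('a::field ^ 2) set \<Rightarrow> bool" where
  "affine_line L \<longleftrightarrow> (\<exists>u v. v \<noteq> 0 \<and> L = {u + t *s v | t. True})"

definition affine_plane_automorphism :: "('a::field ^ 2 \<Rightarrow> 'a ^ 2) \<Rightarrow> bool" where
  "affine_plane_automorphism \<phi> \<longleftrightarrow> bij \<phi> \<and> (\<forall>L. affine_line L \<longrightarrow> affine_line (\<phi> ` L))"

definition affine_integral_automorphism :: "('a::field ^ 2 \<Rightarrow> 'a ^ 2) \<Rightarrow> bool" where
  "affine_integral_automorphism \<phi> \<longleftrightarrow> integral_automorphism \<phi> \<and> affine_plane_automorphism \<phi>"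

definition hyp_a :: "'a::field \<Rightarrow> 'a ^ 2" where
  "hyp_a \<omega> = (1 / 2) *s vector [1, \<omega>]"

definition hyp_b :: "'a::field \<Rightarrow> 'a ^ 2" where
  "hyp_b \<omega> = (1 / 2) *s vector [1, - \<omega>]"

definition hyp_point :: "'a::field \<Rightarrow> 'a \<times> 'a \<Rightarrow> 'a ^ 2" where
  "hyp_point \<omega> = (\<lambda>(\<alpha>, \<beta>). \<alpha> *s hyp_a \<omega> + \<beta> *s hyp_b \<omega>)"

text \<open>
  The description below determines the coordinates as soon as \<open>\<omega>\<^sup>2 = -1\<close> and
  \<open>2 \<noteq> 0\<close>; see \<open>bij_hyp_point\<close>.
\<close>

definition hyp_coords :: "'a::field \<Rightarrow> 'a ^ 2 \<Rightarrow> 'a \<times> 'a" where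
  "hyp_coords \<omega> P = (THE c. P = hyp_point \<omega> c)"

definition hyp_psi :: "'a::field \<Rightarrow> nat \<Rightarrow> 'a ^ 2 \<Rightarrow> 'a ^ 2" where
  "hyp_psi \<omega> p P = (case hyp_coords \<omega> P of (\<alpha>, \<beta>) \<Rightarrow> hyp_point \<omega> (\<alpha>, \<beta> ^ p))"

lemma bij_hyp_point:
  fixes \<omega> :: "'a::field"
  assumes "\<omega> ^ 2 = - 1" and two: "(2::'a) \<noteq> 0"
  shows "bij (hyp_point \<omega>)"
proof -
  have sq: "\<omega> * \<omega> = - 1"
    using assms(1) by (simp add: power2_eq_square)
  have w: "\<omega> \<noteq> 0"
    using sq by auto
  have c1: "hyp_point \<omega> (\<alpha>, \<beta>) $ 1 = (\<alpha> + \<beta>) / 2"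
    and c2: "hyp_point \<omega> (\<alpha>, \<beta>) $ 2 = \<omega> * (\<alpha> - \<beta>) / 2" for \<alpha> \<beta>
    by (simp_all add: hyp_point_def hyp_a_def hyp_b_def field_simps add_divide_distrib diff_divide_distrib)
  show ?thesis
  proof (rule o_bij)
    let ?g = "\<lambda>P :: 'a ^ 2. (P $ 1 - \<omega> * P $ 2, P $ 1 + \<omega> * P $ 2)"
    have assoc: "\<omega> * (\<omega> * z) = - z" for z
      using sq by (simp flip: mult.assoc)
    have half: "x / 2 + x / 2 = x" for x :: 'a
      using two by (simp flip: add_divide_distrib mult_2)
    have "?g (hyp_point \<omega> (\<alpha>, \<beta>)) = (\<alpha>, \<beta>)" for \<alpha> \<beta>
    proof -
      have "\<omega> * hyp_point \<omega> (\<alpha>, \<beta>) $ 2 = (\<beta> - \<alpha>) / 2"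
        using assoc[of "\<alpha> - \<beta>"] by (simp add: c2)
      moreover have "(\<alpha> + \<beta>) / 2 - (\<beta> - \<alpha>) / 2 = \<alpha>" "(\<alpha> + \<beta>) / 2 + (\<beta> - \<alpha>) / 2 = \<beta>"
        using half[of \<alpha>] half[of \<beta>]
        by (simp_all only: add_divide_distrib diff_divide_distrib) (simp_all add: algebra_simps two)
      ultimately show ?thesis
        by (simp only: c1 prod.inject)
    qed
    then show "?g \<circ> hyp_point \<omega> = id"
      by (auto simp: fun_eq_iff)
    have "hyp_point \<omega> (?g P) = P" for P
    proof -
      have "hyp_point \<omega> (?g P) $ 1 = P $ 1"
        using half[of "P $ 1"] by (simp add: c1 add_divide_distrib)
      moreover have "hyp_point \<omega> (?g P) $ 2 = P $ 2"
        using half[of "P $ 2"] by (simp add: c2 assoc algebra_simps add_divide_distrib)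
      ultimately show ?thesis
        by (simp add: vec_eq_iff forall_2)
    qed
    then show "hyp_point \<omega> \<circ> ?g = id"
      by (auto simp: fun_eq_iff)
  qed
qed

lemma hyp_psi_hyp_point:
  fixes \<omega> :: "'a::field"
  assumes "\<omega> ^ 2 = - 1" and "(2::'a) \<noteq> 0"
  shows "hyp_psi \<omega> p (\<alpha> *s hyp_a \<omega> + \<beta> *s hyp_b \<omega>) = \<alpha> *s hyp_a \<omega> + \<beta> ^ p *s hyp_b \<omega>"
proof -
  have "inj (hyp_point \<omega>)"
    using bij_hyp_point[OF assms] by (rule bij_is_inj)
  then have "hyp_coords \<omega> (hyp_point \<omega> c) = c" for c
    unfolding hyp_coords_def by (auto dest: injD)
  from this[of "(\<alpha>, \<beta>)"] show ?thesis
    by (simp add: hyp_psi_def hyp_point_def)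
qed

end

theory Submission
  imports Defs "HOL-Computational_Algebra.Polynomial" "HOL-Number_Theory.Residues"
begin

text \<open>
  In hyperbolic coordinates \<open>N(\<alpha>, \<beta>) = \<alpha>\<beta>\<close>. Since the Frobenius map is additive,
  two points with coordinate differences \<open>(\<alpha>, \<beta>)\<close> are mapped to points with norm
  \<open>\<alpha>\<beta>\<^sup>p = \<alpha>\<beta> (\<beta>\<^bsup>(p-1)/2\<^esup>)\<^sup>2\<close>, which is a square if \<open>\<alpha>\<beta>\<close> is one. The image of the
  line \<open>{(t, t)}\<close> contains \<open>(0, 0)\<close> and \<open>(1, 1)\<close>, so if it were a line it would be
  \<open>{(t, t)}\<close> again, and all \<open>q > p\<close> field elements would be roots of \<open>X\<^sup>p - X\<close>.
\<close>

lemma hyp_point_simps: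
  "hyp_point \<omega> (\<alpha>, \<beta>) $ 1 = (\<alpha> + \<beta>) / 2"
  "hyp_point \<omega> (\<alpha>, \<beta>) $ 2 = \<omega> * (\<alpha> - \<beta>) / 2"
  by (simp_all add: hyp_point_def hyp_a_def hyp_b_def field_simps add_divide_distrib diff_divide_distrib)

lemma hyp_point_diff:
  "hyp_point \<omega> (\<alpha>, \<beta>) - hyp_point \<omega> (\<gamma>, \<delta>) = hyp_point \<omega> (\<alpha> - \<gamma>, \<beta> - \<delta>)"
  by (simp add: vec_eq_iff forall_2 hyp_point_simps flip: diff_divide_distrib)
     (simp add: algebra_simps)

lemma scale_hyp_point: "c *s hyp_point \<omega> (\<alpha>, \<beta>) = hyp_point \<omega> (c * \<alpha>, c * \<beta>)"
  by (simp add: vec_eq_iff forall_2 hyp_point_simps) (simp add: algebra_simps)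

text \<open>Since \<omega>^2 = -1, the sum of squares becomes ((\<alpha> + \<beta>)^2 - (\<alpha> -
  \<beta>)^2) / 4, where only the cross terms survive.\<close>

lemma quad_norm_hyp_point:
  fixes \<omega> :: "'a::field"
  assumes "\<omega> ^ 2 = - 1" and "(2::'a) \<noteq> 0"
  shows "quad_norm (hyp_point \<omega> (\<alpha>, \<beta>)) = \<alpha> * \<beta>"
proof -
  have "(4::'a) = 2 * 2"
    by simp
  then have "(4::'a) \<noteq> 0"
    using assms(2) by (metis mult_eq_0_iff)
  have "quad_norm (hyp_point \<omega> (\<alpha>, \<beta>)) = ((\<alpha> + \<beta>)\<^sup>2 + \<omega>\<^sup>2 * (\<alpha> - \<beta>)\<^sup>2) / 4"
    by (simp add: quad_norm_def hyp_point_simps power_divide power_mult_distrib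
          flip: add_divide_distrib)
  also have "\<dots> = (4 * (\<alpha> * \<beta>)) / 4"
    unfolding assms(1) by (simp add: power2_eq_square algebra_simps)
  finally show ?thesis
    using \<open>4 \<noteq> 0\<close> by simp
qed

lemma hyp_psi_hyp_point_pair:
  fixes \<omega> :: "'a::field"
  assumes "\<omega> ^ 2 = - 1" and "(2::'a) \<noteq> 0"
  shows "hyp_psi \<omega> p (hyp_point \<omega> (\<alpha>, \<beta>)) = hyp_point \<omega> (\<alpha>, \<beta> ^ p)"
  using hyp_psi_hyp_point[OF assms] by (simp add: hyp_point_def)

text \<open>Apply additivity of the Frobenius map to x = (x - y) + y; this avoids evaluating
  (-1)^p.\<close>

lemma frobenius_diff:
  fixes x y :: "'a::comm_ring_1"
  assumes "prime p" and "CHAR('a) = p"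
  shows "(x - y) ^ p = x ^ p - y ^ p"
proof -
  have "((x - y) + y) ^ p = (x - y) ^ p + y ^ p"
    using assms by (intro freshmans_dream) simp_all
  then show ?thesis
    by (simp add: eq_diff_eq)
qed

text \<open>The characteristic of a finite field is a prime, and it divides the order p^r of the
  additive group.\<close>

lemma CHAR_eq_if_CARD_prime_power:
  assumes "prime p" and "CARD('a::{field, finite}) = p ^ r"
  shows "CHAR('a) = p"
proof -
  have "prime CHAR('a)"
    by (intro prime_CHAR_semidom finite_imp_CHAR_pos) simp
  moreover have "CHAR('a) dvd p ^ r"
    using CHAR_dvd_CARD[where 'a = 'a] assms(2) by simp
  then have "CHAR('a) dvd p"
    using \<open>prime CHAR('a)\<close> by (rule prime_dvd_power[rotated])
  ultimately show ?thesis
    using assms(1) by (intro primes_dvd_imp_eq)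
qed

lemma integral_automorphism_hyp_psi:
  fixes \<omega> :: "'a::{field, finite}"
  assumes p: "prime p" "CHAR('a) = p" "odd p" and \<omega>: "\<omega> ^ 2 = - 1" "(2::'a) \<noteq> 0"
  shows "integral_automorphism (hyp_psi \<omega> p)"
proof -
  note diff = frobenius_diff[OF p(1,2)]
  have ex: "\<exists>\<alpha> \<beta>. x = hyp_point \<omega> (\<alpha>, \<beta>)" for x
    using bij_hyp_point[OF \<omega>] by (metis bij_pointE surj_pair)
  have point_eq: "c = d" if "hyp_point \<omega> c = hyp_point \<omega> d" for c d
    using bij_hyp_point[OF \<omega>] that by (metis bij_pointE)
  \<comment> \<open>Here (x - y)^p = x^p - y^p = 0, and a field has no nonzero nilpotents.\<close>
  have frob_inj: "x = y" if "x ^ p = y ^ p" for x y :: 'a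
    using diff[of x y] that by simp
  have "inj (hyp_psi \<omega> p)"
  proof (rule injI)
    fix x y assume eq: "hyp_psi \<omega> p x = hyp_psi \<omega> p y"
    obtain \<alpha> \<beta> \<gamma> \<delta> where xy: "x = hyp_point \<omega> (\<alpha>, \<beta>)" "y = hyp_point \<omega> (\<gamma>, \<delta>)"
      using ex by meson
    have "(\<alpha>, \<beta> ^ p) = (\<gamma>, \<delta> ^ p)"
      using eq unfolding xy hyp_psi_hyp_point_pair[OF \<omega>] by (rule point_eq)
    then show "x = y"
      using frob_inj[of \<beta> \<delta>] by (simp add: xy)
  qed
  then have "bij (hyp_psi \<omega> p)"
    by (simp add: bij_def finite_UNIV_inj_surj)
  moreover have "integral_distance (hyp_psi \<omega> p x) (hyp_psi \<omega> p y)"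
    if xy_int: "integral_distance x y" for x y
  proof -
    obtain \<alpha> \<beta> \<gamma> \<delta> where xy: "x = hyp_point \<omega> (\<alpha>, \<beta>)" "y = hyp_point \<omega> (\<gamma>, \<delta>)"
      using ex by meson
    obtain d where d: "(\<alpha> - \<gamma>) * (\<beta> - \<delta>) = d ^ 2"
      using xy_int by (auto simp: integral_distance_def squares_def xy hyp_point_diff quad_norm_hyp_point[OF \<omega>])
    \<comment> \<open>With k = (p - 1)/2, passing from \<beta> - \<delta> to its p-th power
      multiplies the norm by the square of (\<beta> - \<delta>)^k.\<close>
    obtain k where k: "p = Suc (2 * k)"
      using p(3) by (auto elim: oddE)
    have "(\<alpha> - \<gamma>) * (\<beta> ^ p - \<delta> ^ p) = (\<alpha> - \<gamma>) * (\<beta> - \<delta>) ^ p"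
      by (simp add: diff)
    also have "\<dots> = (\<alpha> - \<gamma>) * (\<beta> - \<delta>) * ((\<beta> - \<delta>) ^ k) ^ 2"
      by (simp add: k power_even_eq)
    also have "\<dots> = (d * (\<beta> - \<delta>) ^ k) ^ 2"
      by (simp add: d power_mult_distrib)
    finally have "(\<alpha> - \<gamma>) * (\<beta> ^ p - \<delta> ^ p) \<in> squares"
      unfolding squares_def by blast
    then show ?thesis
      by (simp add: integral_distance_def xy hyp_psi_hyp_point_pair[OF \<omega>]
            hyp_point_diff quad_norm_hyp_point[OF \<omega>])
  qed
  ultimately show ?thesis
    by (simp add: integral_automorphism_def)
qed

text \<open>A line through the origin is a one-dimensional subspace, so any nonzero point of it
  spans it.\<close>

lemma affine_line_through_0:
  assumes "affine_line L" and "0 \<in> L" and "c \<in> L" and "c \<noteq> 0" and "x \<in> L"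
  shows "\<exists>k. x = k *s c"
proof -
  obtain u v where L: "L = {u + t *s v | t. True}"
    using assms(1) by (auto simp: affine_line_def)
  \<comment> \<open>\<open>s0\<close> is the parameter of the origin; measured from it, every point
    of the line is a multiple of \<open>v\<close>.\<close>
  obtain s0 s1 s where s: "u + s0 *s v = 0" "c = u + s1 *s v" "x = u + s *s v"
    using assms(2,3,5) unfolding L by (smt (verit) mem_Collect_eq)
  have u: "u = - (s0 *s v)"
    using s(1) by (simp add: eq_neg_iff_add_eq_0)
  have c: "c = (s1 - s0) *s v" and x: "x = (s - s0) *s v"
    unfolding s(2,3) u by (simp_all add: vec.scale_left_diff_distrib)
  have "s1 - s0 \<noteq> 0"
    using c assms(4) by auto
  then have "x = ((s - s0) / (s1 - s0)) *s c"
    by (simp add: c x)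
  then show ?thesis ..
qed

lemma frobenius_nontrivial:
  assumes "p \<ge> 2" and "CARD('a::{field, finite}) > p"
  shows "\<exists>t::'a. t ^ p \<noteq> t"
proof (rule ccontr)
  assume "\<not> ?thesis"
  then have all: "t ^ p = t" for t :: 'a
    by blast
  define f :: "'a poly" where "f = Polynomial.monom 1 p - Polynomial.monom 1 1"
  \<comment> \<open>Because p > 1, the term X cannot cancel X^p, so \<open>f\<close> is nonzero and
    has at most p roots.\<close>
  have "Polynomial.coeff f p = 1"
    using assms(1) by (simp add: f_def)
  then have "f \<noteq> 0"
    by auto
  have "{t. poly f t = 0} = UNIV"
    by (simp add: f_def poly_monom all)
  then have "CARD('a) \<le> Polynomial.degree f"
    using card_poly_roots_bound[OF \<open>f \<noteq> 0\<close>] by simp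
  also have "Polynomial.degree f \<le> p"
    unfolding f_def using assms(1) by (intro degree_diff_le) (auto simp: Polynomial.degree_monom_eq)
  finally show False
    using assms(2) by simp
qed

lemma not_affine_plane_automorphism_hyp_psi:
  fixes \<omega> :: "'a::{field, finite}"
  assumes "p \<ge> 2" "CARD('a) > p" and \<omega>: "\<omega> ^ 2 = - 1" "(2::'a) \<noteq> 0"
  shows "\<not> affine_plane_automorphism (hyp_psi \<omega> p)"
proof
  assume aut: "affine_plane_automorphism (hyp_psi \<omega> p)"
  define c where "c = hyp_point \<omega> (1, 1)"
  define L where "L = {0 + t *s c | t. True}"
  have point_eq: "c = d" if "hyp_point \<omega> c = hyp_point \<omega> d" for c d
    using bij_hyp_point[OF \<omega>] that by (metis bij_pointE)
  have zero: "hyp_point \<omega> (0, 0) = 0"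
    by (simp add: hyp_point_def)
  have "c \<noteq> 0"
    unfolding c_def zero[symmetric] using point_eq by fastforce
  then have "affine_line L"
    unfolding affine_line_def L_def by blast
  then have line: "affine_line (hyp_psi \<omega> p ` L)"
    using aut by (simp add: affine_plane_automorphism_def)
  have mem: "hyp_point \<omega> (t, t ^ p) \<in> hyp_psi \<omega> p ` L" for t
  proof -
    have "hyp_point \<omega> (t, t) \<in> L"
      by (auto simp: L_def c_def scale_hyp_point)
    then show ?thesis
      by (metis hyp_psi_hyp_point_pair[OF \<omega>] imageI)
  qed
  \<comment> \<open>The parameters 0 and 1 are fixed by the p-th power map; 0^p = 0 uses p >
    0.\<close>
  have "0 \<in> hyp_psi \<omega> p ` L" "c \<in> hyp_psi \<omega> p ` L"
    using mem[of 0] mem[of 1] assms(1) by (auto simp: zero c_def power_0_left)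
  then have "\<exists>k. hyp_point \<omega> (t, t ^ p) = k *s c" for t
    using affine_line_through_0[OF line _ _ \<open>c \<noteq> 0\<close> mem] by blast
  \<comment> \<open>Uniqueness of hyperbolic coordinates turns (t, t^p) = (k, k) into t = k =
    t^p.\<close>
  then have "t ^ p = t" for t :: 'a
    unfolding c_def scale_hyp_point using point_eq by fastforce
  then show False
    using frobenius_nontrivial[OF assms(1,2)] by blast
qed

theorem theorem4:
  fixes \<omega> :: "'a::{field, finite}" and p r :: nat
  assumes "prime p" and "r \<ge> 2"
    and "CARD('a) = p ^ r" and "CARD('a) mod 4 = 1"
    and "\<omega> ^ 2 = - 1"
  shows "integral_automorphism (hyp_psi \<omega> p) \<and> \<not> affine_integral_automorphism (hyp_psi \<omega> p)"
proof -
  have p: "CHAR('a) = p"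
    using CHAR_eq_if_CARD_prime_power assms(1,3) by blast
  have "p \<ge> 2"
    using assms(1) by (rule prime_ge_2_nat)
  have "odd (p ^ r)"
    using assms(3,4) by presburger
  then have "odd p"
    using assms(2) by simp
  have two: "(2::'a) \<noteq> 0"
  proof
    assume "(2::'a) = 0"
    then have "p dvd 2"
      using of_nat_eq_0_iff_char_dvd[where 'a = 'a, of 2] p by simp
    then have "p = 2"
      using \<open>p \<ge> 2\<close> by (simp add: dvd_imp_le le_antisym)
    then show False
      using \<open>odd p\<close> by simp
  qed
  \<comment> \<open>This is where r \<ge> 2 is essential: for r = 1 the p-th power map is the
    identity, and so is \<psi>.\<close>
  have "CARD('a) > p"
    using power_strict_increasing[of 1 r p] assms(2,3) \<open>p \<ge> 2\<close> by simp
  then show ?thesis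
    using integral_automorphism_hyp_psi[OF assms(1) p \<open>odd p\<close> assms(5) two]
      not_affine_plane_automorphism_hyp_psi[OF \<open>p \<ge> 2\<close> _ assms(5) two]
    by (simp add: affine_integral_automorphism_def)
qed

end
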